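(* Let $\mathcal{D}(S)$ be the set of all $f:(-1,1)\to\mathbb{C}$ such that $f,f',f'',f'''\in AC_{\mathrm{loc}}(-1,1)$, $f,\ell^2[f]\in L^2(-1,1)$, $\lim_{x\to\pm1}[f,1]_2(x)=0$ and $\lim_{x\to\pm1}[f,x]_2(x)=0$. Let $D$ be the set of all $f:(-1,1)\to\mathbb{C}$ such that $f,f',f'',f'''\in AC_{\mathrm{loc}}(-1,1)$, $f,\ell^2[f]\in L^2(-1,1)$, $\lim_{x\to\pm1}(1-x^2)f'(x)=0$ and $\lim_{x\to\pm1}\left((1-x^2)^2f''(x)\right)'=0$. Then $$D=\mathcal{D}(S).$$
   Context: $AC_{\mathrm{loc}}(-1,1)$ denotes the complex-valued functions on $(-1,1)$ that are absolutely continuous on every compact subinterval. The square of the Legendre expression is $$\ell^2[y](x)=\left((1-x^2)^2y''(x)\right)''-2\left((1-x^2)y'(x)\right)' ,$$ defined for a.e. $x\in(-1,1)$. The associated sesquilinear form is $$[f,g]_2(x)=\left((1-x^2)^2f''\right)'\overline{g}-\left((1-x^2)^2\overline{g}''\right)'f-(1-x^2)^2f''\overline{g}'+(1-x^2)^2f'\overline{g}''-2(1-x^2)f'\overline{g}+2(1-x^2)f\overline{g}',$$ all functions evaluated at $x\in(-1,1)$. In $[f,1]_2$ and $[f,x]_2$ the second argument is the constant function $1$, respectively the identity function $x\mapsto x$; thus $[f,1]_2(x)=\left((1-x^2)^2f''(x)\right)'-2(1-x^2)f'(x)$ and $[f,x]_2(x)=x[f,1]_2(x)-(1-x^2)^2f''(x)+2(1-x^2)f(x)$.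 A limit "$x\to\pm1$" means both one-sided limits, $x\to1^-$ and $x\to-1^+$. *)

theory Defs
  imports "HOL-Analysis.Analysis"
begin

(* Elements of a division of a subset of {a..b} are nonempty closed intervals {Inf k..Sup k}
   with pairwise disjoint interiors; degenerate ones contribute 0 to both sums. *)
definition abs_continuous_on_interval :: "real \<Rightarrow> real \<Rightarrow> (real \<Rightarrow> complex) \<Rightarrow> bool" where
  "abs_continuous_on_interval a b f \<longleftrightarrow>
     (\<forall>\<epsilon>>0. \<exists>\<delta>>0. \<forall>\<D>. \<D> division_of (\<Union>\<D>) \<and> \<Union>\<D> \<subseteq> {a..b} \<and>
        (\<Sum>k\<in>\<D>. Sup k - Inf k) < \<delta> \<longrightarrow> (\<Sum>k\<in>\<D>. norm (f (Sup k) - f (Inf k))) < \<epsilon>)"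

definition AC_loc :: "(real \<Rightarrow> complex) set" where
  "AC_loc = {f. \<forall>a b. -1 < a \<and> a \<le> b \<and> b < 1 \<longrightarrow> abs_continuous_on_interval a b f}"

abbreviation Dx :: "(real \<Rightarrow> complex) \<Rightarrow> real \<Rightarrow> complex" where
  "Dx f \<equiv> (\<lambda>x. vector_derivative f (at x))"

(* f, f', f'', f''' in AC_loc. Since vector_derivative is total (with junk values where the
   derivative does not exist), the existence of the derivatives on (-1,1) is explicit. *)
definition AC_loc3 :: "(real \<Rightarrow> complex) \<Rightarrow> bool" where
  "AC_loc3 f \<longleftrightarrow>
     f \<in> AC_loc \<and>
     f differentiable_on {-1<..<1} \<and> Dx f \<in> AC_loc \<and>
     Dx f differentiable_on {-1<..<1} \<and> Dx (Dx f) \<in> AC_loc \<and>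
     Dx (Dx f) differentiable_on {-1<..<1} \<and> Dx (Dx (Dx f)) \<in> AC_loc"

(* Square-integrability with respect to Lebesgue measure. The completed measure is used so that
   the values of a function on a null set (where a derivative may fail to exist) do not matter. *)
definition L2 :: "(real \<Rightarrow> complex) set" where
  "L2 = {f. f \<in> borel_measurable (lebesgue_on {-1<..<1}) \<and>
            integrable (lebesgue_on {-1<..<1}) (\<lambda>x. (norm (f x))\<^sup>2)}"

definition legendre_sq :: "(real \<Rightarrow> complex) \<Rightarrow> real \<Rightarrow> complex" where
  "legendre_sq y x =
     Dx (Dx (\<lambda>t. of_real ((1 - t\<^sup>2)\<^sup>2) * Dx (Dx y) t)) x
     - 2 * Dx (\<lambda>t. of_real (1 - t\<^sup>2) * Dx y t) x"

definition legendre_sq_form ::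
    "(real \<Rightarrow> complex) \<Rightarrow> (real \<Rightarrow> complex) \<Rightarrow> real \<Rightarrow> complex" where
  "legendre_sq_form f g x =
     (let gc = (\<lambda>t. cnj (g t)); p = (\<lambda>t. of_real (1 - t\<^sup>2)) in
        Dx (\<lambda>t. (p t)\<^sup>2 * Dx (Dx f) t) x * gc x
      - Dx (\<lambda>t. (p t)\<^sup>2 * Dx (Dx gc) t) x * f x
      - (p x)\<^sup>2 * Dx (Dx f) x * Dx gc x
      + (p x)\<^sup>2 * Dx f x * Dx (Dx gc) x
      - 2 * p x * Dx f x * gc x
      + 2 * p x * f x * Dx gc x)"

definition vanishes_at_endpoints :: "(real \<Rightarrow> complex) \<Rightarrow> bool" where
  "vanishes_at_endpoints h \<longleftrightarrow> (h \<longlongrightarrow> 0) (at_left 1) \<and> (h \<longlongrightarrow> 0) (at_right (-1))"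

(* A function on (-1,1) is represented by its extension that is undefined outside (-1,1). *)
definition max_domain :: "(real \<Rightarrow> complex) set" where
  "max_domain = {f \<in> {-1<..<1} \<rightarrow>\<^sub>E UNIV. AC_loc3 f \<and> f \<in> L2 \<and> legendre_sq f \<in> L2}"

definition dom_S :: "(real \<Rightarrow> complex) set" where
  "dom_S = {f \<in> max_domain.
     vanishes_at_endpoints (legendre_sq_form f (\<lambda>x. 1)) \<and>
     vanishes_at_endpoints (legendre_sq_form f (\<lambda>x. of_real x))}"

definition dom_D :: "(real \<Rightarrow> complex) set" where
  "dom_D = {f \<in> max_domain.
     vanishes_at_endpoints (\<lambda>x. of_real (1 - x\<^sup>2) * Dx f x) \<and>
     vanishes_at_endpoints (Dx (\<lambda>t. of_real ((1 - t\<^sup>2)\<^sup>2) * Dx (Dx f) t))}"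

end

theory Submission
  imports Defs
begin

text \<open>
  Write p(x) = 1 - x^2 and v = (p^2 f'')'. Since [f,1] = v - 2 p f' and
  [f,x] = x [f,1] - (p^2 f'' - 2 p f), everything rests on one form of L'Hopital's rule with
  denominator 1/p: if p^2 g' has the limit l at the endpoint 1, then p g has the limit l/2.
  If p f' and v tend to 0, then so does p f (take g = f), and p^2 f'' has a limit, because its
  derivative v is bounded; this limit is 0 (take g = f', as p f' tends to 0). Conversely, if
  [f,1] and [f,x] tend to 0, then so does p^2 f'' - 2 p f. As f is integrable, it has a primitive F
  vanishing at the endpoint; taking g = f' - 2 F / p, where p^2 g' = p^2 f'' - 2 p f - 4 x F,
  shows that p f' tends to 0. The endpoint -1 is treated by reflection.
\<close>

section \<open>L'Hopital's rule with denominator 1/(1 - x^2)\<close>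

text \<open>With p = 1 - x^2, the function 1/p tends to infinity at 1 and has derivative 2x/p^2,
  which is nonzero on (0,1). The quotient of derivatives is therefore p^2 g'/(2x), with limit
  l/2.\<close>

lemma lhopital_weight_real:
  fixes g g' :: "real \<Rightarrow> real"
  assumes der: "\<And>x. x \<in> {0<..<1} \<Longrightarrow> (g has_real_derivative g' x) (at x)"
    and lim: "((\<lambda>x. (1 - x\<^sup>2)\<^sup>2 * g' x) \<longlongrightarrow> l) (at_left 1)"
  shows "((\<lambda>x. (1 - x\<^sup>2) * g x) \<longlongrightarrow> l / 2) (at_left 1)"
proof -
  have ev: "eventually (\<lambda>x. x \<in> {0<..<1::real}) (at_left 1)"
    by (rule eventually_at_leftI[of 0]) auto
  have pos: "1 - x\<^sup>2 > 0" if "x \<in> {0<..<1::real}" for x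
    using that by (simp add: power_less_one_iff)
  have "((\<lambda>x. g x / (1 / (1 - x\<^sup>2))) \<longlongrightarrow> l / 2) (at_left 1)"
  proof (rule lhopital_left_at_top)
    show "LIM x at_left 1. 1 / (1 - x\<^sup>2) :: real :> at_top"
    proof -
      have "((\<lambda>x::real. 1 - x\<^sup>2) \<longlongrightarrow> 1 - 1\<^sup>2) (at_left 1)"
        by (intro tendsto_intros)
      then have "filterlim (\<lambda>x::real. 1 - x\<^sup>2) (at_right 0) (at_left 1)"
        using eventually_mono[OF ev, of "\<lambda>x. 1 - x\<^sup>2 > 0"] pos
        by (auto simp: filterlim_at elim: eventually_mono)
      from filterlim_compose[OF filterlim_inverse_at_top_right this]
      show ?thesis by (simp add: inverse_eq_divide)
    qed
    show "eventually (\<lambda>x. (g has_real_derivative g' x) (at x)) (at_left 1)"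
      using ev by eventually_elim (rule der)
    show "eventually (\<lambda>x. ((\<lambda>x. 1 / (1 - x\<^sup>2)) has_real_derivative 2 * x / (1 - x\<^sup>2)\<^sup>2) (at x))
        (at_left 1)"
      using ev
    proof eventually_elim
      case (elim x)
      show ?case
        using pos[OF elim]
        by (auto intro!: derivative_eq_intros simp: power2_eq_square)
    qed
    show "eventually (\<lambda>x::real. 2 * x / (1 - x\<^sup>2)\<^sup>2 \<noteq> 0) (at_left 1)"
      using ev
    proof eventually_elim
      case (elim x)
      then show ?case using pos[OF elim] by auto
    qed
    have "((\<lambda>x. ((1 - x\<^sup>2)\<^sup>2 * g' x) / (2 * x)) \<longlongrightarrow> l / (2 * 1)) (at_left 1)"
      by (intro tendsto_intros lim) auto
    then show "((\<lambda>x. g' x / (2 * x / (1 - x\<^sup>2)\<^sup>2)) \<longlongrightarrow> l / 2) (at_left 1)"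
      by (simp add: mult.commute)
  qed
  then show ?thesis by (simp add: mult.commute)
qed

text \<open>L'Hopital's rule rests on a mean value argument for real functions. Since the weight is
  real, it can be applied to the real and the imaginary part separately.\<close>

lemma lhopital_weight:
  fixes g g' :: "real \<Rightarrow> complex"
  assumes der: "\<And>x. x \<in> {0<..<1} \<Longrightarrow> (g has_vector_derivative g' x) (at x)"
    and lim: "((\<lambda>x. of_real ((1 - x\<^sup>2)\<^sup>2) * g' x) \<longlongrightarrow> l) (at_left 1)"
  shows "((\<lambda>x. of_real (1 - x\<^sup>2) * g x) \<longlongrightarrow> l / 2) (at_left 1)"
proof -
  have re: "((\<lambda>x. (1 - x\<^sup>2) * Re (g x)) \<longlongrightarrow> Re l / 2) (at_left 1)"
  proof (rule lhopital_weight_real)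
    show "((\<lambda>x. Re (g x)) has_real_derivative Re (g' x)) (at x)" if "x \<in> {0<..<1}" for x
      using bounded_linear.has_vector_derivative[OF bounded_linear_Re der[OF that]]
      by (simp add: has_real_derivative_iff_has_vector_derivative)
    show "((\<lambda>x. (1 - x\<^sup>2)\<^sup>2 * Re (g' x)) \<longlongrightarrow> Re l) (at_left 1)"
      using tendsto_Re[OF lim] unfolding Re_complex_of_real[symmetric] by simp
  qed
  have im: "((\<lambda>x. (1 - x\<^sup>2) * Im (g x)) \<longlongrightarrow> Im l / 2) (at_left 1)"
  proof (rule lhopital_weight_real)
    show "((\<lambda>x. Im (g x)) has_real_derivative Im (g' x)) (at x)" if "x \<in> {0<..<1}" for x
      using bounded_linear.has_vector_derivative[OF bounded_linear_Im der[OF that]]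
      by (simp add: has_real_derivative_iff_has_vector_derivative)
    show "((\<lambda>x. (1 - x\<^sup>2)\<^sup>2 * Im (g' x)) \<longlongrightarrow> Im l) (at_left 1)"
      using tendsto_Im[OF lim] by simp
  qed
  show ?thesis
    unfolding tendsto_complex_iff using re im by simp
qed

section \<open>Limits and primitives up to an endpoint\<close>

text \<open>Near \<open>b\<close> the derivative has norm below 1, so \<open>u\<close> is Lipschitz
  there, hence uniformly continuous, and by completeness it extends continuously to
  \<open>b\<close>.\<close>

lemma has_limit_if_deriv_tendsto_0:
  fixes u v :: "real \<Rightarrow> 'a :: banach"
  assumes der: "\<And>x. x \<in> {a<..<b} \<Longrightarrow> (u has_vector_derivative v x) (at x)"
    and "a < b" and lim: "(v \<longlongrightarrow> 0) (at_left b)"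
  obtains l where "(u \<longlongrightarrow> l) (at_left b)"
proof -
  have "eventually (\<lambda>x. norm (v x) < 1) (at_left b)"
    using tendsto_norm[OF lim] by (auto intro: order_tendstoD)
  then obtain c0 where c0: "c0 < b" "\<And>x. c0 < x \<Longrightarrow> x < b \<Longrightarrow> norm (v x) < 1"
    by (auto simp: eventually_at_left_field)
  define c where "c = max a c0"
  have c: "c < b" "\<And>x. c < x \<Longrightarrow> x < b \<Longrightarrow> norm (v x) < 1" "a \<le> c"
    using c0 \<open>a < b\<close> by (auto simp: c_def)
  have "norm (u x - u y) \<le> 1 * norm (x - y)" if "x \<in> {c<..<b}" "y \<in> {c<..<b}" for x y
  proof (rule differentiable_bound[where S = "{c<..<b}" and f' = "\<lambda>x t. t *\<^sub>R v x"])
    fix z assume z: "z \<in> {c<..<b}"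
    show "(u has_derivative (\<lambda>t. t *\<^sub>R v z)) (at z within {c<..<b})"
      using der[of z] z c by (auto simp: has_vector_derivative_def intro: has_derivative_at_withinI)
    show "onorm (\<lambda>t. t *\<^sub>R v z) \<le> 1"
      using c(2)[of z] z by (auto intro!: onorm_bound simp: mult_left_le)
  qed (use that in auto)
  then have "1-lipschitz_on {c<..<b} u"
    by (intro lipschitz_onI) (auto simp: dist_norm)
  then have "uniformly_continuous_on {c<..<b} u"
    by (rule lipschitz_on_uniformly_continuous)
  then obtain l where "(u \<longlongrightarrow> l) (at b within {c<..<b})"
    by (rule uniformly_continuous_on_extension_at_closure[where x = b])
       (use c in \<open>auto simp: closure_greaterThanLessThan\<close>)
  moreover have "at b within {c<..<b} = at_left b"
    using c(1) by (intro at_within_nhd[where S = "{c<..}"]) auto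
  ultimately show ?thesis
    using that by simp
qed

text \<open>The primitive is minus the integral of \<open>f\<close> from x to \<open>b\<close>.
  Integrability up to \<open>b\<close> makes it continuous at \<open>b\<close>; continuity of
  \<open>f\<close> in the interior makes its derivative equal to \<open>f\<close> at every point,
  not just almost everywhere.\<close>

lemma primitive_vanishing_at_endpoint:
  fixes f :: "real \<Rightarrow> 'a :: banach"
  assumes int: "f integrable_on {a..b}" and cont: "continuous_on {a<..<b} f" and "a < b"
  obtains F where "\<And>x. x \<in> {a<..<b} \<Longrightarrow> (F has_vector_derivative f x) (at x)"
    and "(F \<longlongrightarrow> 0) (at_left b)"
proof -
  define F where "F = (\<lambda>x. integral {a..x} f - integral {a..b} f)"
  have "continuous_on {a..b} F"
    unfolding F_def by (intro continuous_intros indefinite_integral_continuous_1 int)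
  then have "(F \<longlongrightarrow> F b) (at b within {a..b})"
    using \<open>a < b\<close> by (auto simp: continuous_on_def)
  then have 1: "(F \<longlongrightarrow> 0) (at_left b)"
    using \<open>a < b\<close> at_within_Icc_at_left[of a b] by (simp add: F_def)
  have 2: "(F has_vector_derivative f x) (at x)" if x: "x \<in> {a<..<b}" for x
  proof -
    have "continuous (at x within {a..b}) f"
      using cont x by (simp add: continuous_on_eq_continuous_at continuous_at_imp_continuous_at_within)
    then have "((\<lambda>x. integral {a..x} f) has_vector_derivative f x) (at x within {a..b})"
      using integral_has_vector_derivative_continuous_at[OF int, of x "{}"] x by auto
    then have "((\<lambda>x. integral {a..x} f) has_vector_derivative f x) (at x)"
      using x by (simp add: at_within_Icc_at)
    then show ?thesis
      unfolding F_def by (auto intro!: derivative_eq_intros)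
  qed
  show ?thesis using that 1 2 by blast
qed

section \<open>The equivalence at the endpoint 1\<close>

text \<open>Here \<open>?C\<close> and \<open>?E\<close> are the conditions on [f,1] and [f,x]. The
  derivatives are arbitrary functions \<open>f1\<close>, \<open>f2\<close>, \<open>v\<close>, so
  that the result applies both to a function of the domain and to its reflection.\<close>

lemma endpoint_conditions_iff:
  fixes f f1 f2 v :: "real \<Rightarrow> complex"
  assumes f: "\<And>x. x \<in> {0<..<1} \<Longrightarrow> (f has_vector_derivative f1 x) (at x)"
    and f1: "\<And>x. x \<in> {0<..<1} \<Longrightarrow> (f1 has_vector_derivative f2 x) (at x)"
    and v: "\<And>x. x \<in> {0<..<1} \<Longrightarrow>
      ((\<lambda>t. of_real ((1 - t\<^sup>2)\<^sup>2) * f2 t) has_vector_derivative v x) (at x)"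
    and int: "f integrable_on {0..1}"
  defines "p \<equiv> \<lambda>x. complex_of_real (1 - x\<^sup>2)"
  shows "((\<lambda>x. p x * f1 x) \<longlongrightarrow> 0) (at_left 1) \<and> (v \<longlongrightarrow> 0) (at_left 1) \<longleftrightarrow>
    ((\<lambda>x. v x - 2 * p x * f1 x) \<longlongrightarrow> 0) (at_left 1) \<and>
    ((\<lambda>x. of_real x * (v x - 2 * p x * f1 x) - (p x)\<^sup>2 * f2 x + 2 * p x * f x) \<longlongrightarrow> 0) (at_left 1)"
    (is "?A \<and> ?B \<longleftrightarrow> ?C \<and> ?E")
proof
  have p0: "(p \<longlongrightarrow> 0) (at_left 1)"
    unfolding p_def by (auto intro!: tendsto_eq_intros)
  have x1: "((\<lambda>x. complex_of_real x) \<longlongrightarrow> 1) (at_left 1)"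
    by (auto intro!: tendsto_eq_intros)
  have p2: "of_real ((1 - x\<^sup>2)\<^sup>2) = (p x)\<^sup>2" for x
    by (simp add: p_def)
  {
    assume *: "?A \<and> ?B"
    have C: ?C
      using tendsto_diff[OF conjunct2[OF *] tendsto_mult[OF tendsto_const conjunct1[OF *], of 2]]
      by (simp add: mult.assoc)
    \<comment> \<open>A further factor \<open>p\<close>, which tends to 0, puts the limit of
      \<open>p * f1\<close> into the form required by the rule for g = \<open>f\<close>.\<close>
    have "((\<lambda>x. of_real ((1 - x\<^sup>2)\<^sup>2) * f1 x) \<longlongrightarrow> 0) (at_left 1)"
      using tendsto_mult[OF p0 conjunct1[OF *]] unfolding p2
      by (simp add: power2_eq_square mult.assoc)
    from lhopital_weight[OF f this]
    have pf: "((\<lambda>x. p x * f x) \<longlongrightarrow> 0) (at_left 1)" by (simp add: p_def)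
    obtain l where l: "((\<lambda>x. of_real ((1 - x\<^sup>2)\<^sup>2) * f2 x) \<longlongrightarrow> l) (at_left 1)"
      using v zero_less_one conjunct2[OF *] by (rule has_limit_if_deriv_tendsto_0)
    \<comment> \<open>The rule for g = \<open>f1\<close> gives \<open>p * f1\<close> the limit
      \<open>l / 2\<close>, while the assumption gives it the limit 0; hence
      \<open>l = 0\<close>.\<close>
    from lhopital_weight[OF f1 this] have "((\<lambda>x. p x * f1 x) \<longlongrightarrow> l / 2) (at_left 1)"
      by (simp add: p_def)
    with * have "l = 0"
      using tendsto_unique[of "at_left (1::real)"] by fastforce
    with l have pf2: "((\<lambda>x. (p x)\<^sup>2 * f2 x) \<longlongrightarrow> 0) (at_left 1)"
      by (simp only: p2)
    have ?E
      using tendsto_add[OF tendsto_diff[OF tendsto_mult[OF x1 C] pf2]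
          tendsto_mult[OF tendsto_const pf, of 2]]
      by (simp add: mult.assoc)
    with C show "?C \<and> ?E" ..
  next
    assume *: "?C \<and> ?E"
    \<comment> \<open>This is x [f,1] - [f,x].\<close>
    have e: "((\<lambda>x. (p x)\<^sup>2 * f2 x - 2 * p x * f x) \<longlongrightarrow> 0) (at_left 1)"
      using tendsto_diff[OF tendsto_mult[OF x1 conjunct1[OF *]] conjunct2[OF *]]
      by (simp add: algebra_simps)
    have "continuous_on {0<..<1} f"
      using f by (meson continuous_at_imp_continuous_on has_vector_derivative_continuous)
    then obtain F where F: "\<And>x. x \<in> {0<..<1} \<Longrightarrow> (F has_vector_derivative f x) (at x)"
      and F0: "(F \<longlongrightarrow> 0) (at_left 1)"
      using primitive_vanishing_at_endpoint[OF int] by (metis zero_less_one)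
    \<comment> \<open>The rule for \<open>f1\<close> alone would need the limit of
      \<open>p^2 * f2\<close>, but only that of \<open>p^2 * f2 - 2 * p * f\<close> is known.
      Subtracting \<open>2 * F / p\<close> from \<open>f1\<close> produces the missing term
      \<open>- 2 * p * f\<close>; the extra term -4 x F vanishes in the limit.\<close>
    define g where "g = (\<lambda>x. f1 x - 2 * F x * of_real (1 / (1 - x\<^sup>2)))"
    define g' where "g' = (\<lambda>x. f2 x - 2 * f x * of_real (1 / (1 - x\<^sup>2))
                               - 2 * F x * of_real (2 * x / (1 - x\<^sup>2)\<^sup>2))"
    have nz: "1 - x\<^sup>2 \<noteq> 0" if "x \<in> {0<..<1::real}" for x
      using that by (simp add: power2_eq_1_iff)
    have ev: "eventually (\<lambda>x. x \<in> {0<..<1::real}) (at_left 1)"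
      by (rule eventually_at_leftI[of 0]) auto
    have "(g has_vector_derivative g' x) (at x)" if x: "x \<in> {0<..<1}" for x
    proof -
      have "((\<lambda>x. 1 / (1 - x\<^sup>2)) has_real_derivative 2 * x / (1 - x\<^sup>2)\<^sup>2) (at x)"
        using nz[OF x] by (auto intro!: derivative_eq_intros simp: power2_eq_square)
      from has_vector_derivative_of_real[OF this, where 'a = complex]
      have q: "((\<lambda>x. complex_of_real (1 / (1 - x\<^sup>2))) has_vector_derivative
          of_real (2 * x / (1 - x\<^sup>2)\<^sup>2)) (at x)" .
      show ?thesis
        unfolding g_def g'_def
        by (rule derivative_eq_intros refl f1[OF x] F[OF x] q)+ (simp add: algebra_simps)
    qed
    moreover have "((\<lambda>x. of_real ((1 - x\<^sup>2)\<^sup>2) * g' x) \<longlongrightarrow> 0) (at_left 1)"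
    proof (rule Lim_transform_eventually)
      show "((\<lambda>x. ((p x)\<^sup>2 * f2 x - 2 * p x * f x) - 4 * of_real x * F x) \<longlongrightarrow> 0) (at_left 1)"
        using tendsto_diff[OF e tendsto_mult[OF tendsto_mult[OF tendsto_const x1, of 4] F0]] by simp
      show "eventually (\<lambda>x. (p x)\<^sup>2 * f2 x - 2 * p x * f x - 4 * of_real x * F x =
          of_real ((1 - x\<^sup>2)\<^sup>2) * g' x) (at_left 1)"
        using ev
      proof eventually_elim
        case (elim x)
        have "p x \<noteq> 0" using nz[OF elim] by (simp only: p_def of_real_eq_0_iff not_False_eq_True)
        then have "(p x)\<^sup>2 * (2 * f x / p x) = 2 * p x * f x"
            "(p x)\<^sup>2 * (4 * of_real x * F x / (p x)\<^sup>2) = 4 * of_real x * F x"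
          by (simp_all add: power2_eq_square)
        moreover have "g' x = f2 x - 2 * f x / p x - 4 * of_real x * F x / (p x)\<^sup>2"
          by (simp add: g'_def p_def)
        ultimately show ?case
          by (simp only: p2 right_diff_distrib)
      qed
    qed
    ultimately have gl: "((\<lambda>x. p x * g x) \<longlongrightarrow> 0) (at_left 1)"
      using lhopital_weight[of g g' 0] by (simp add: p_def)
    \<comment> \<open>The correction disappears after multiplication by \<open>p\<close>:
      \<open>p * g\<close> differs from \<open>p * f1\<close> only by \<open>2 * F\<close>, which
      tends to 0.\<close>
    have A: ?A
    proof (rule Lim_transform_eventually)
      show "((\<lambda>x. p x * g x + 2 * F x) \<longlongrightarrow> 0) (at_left 1)"
        using tendsto_add[OF gl tendsto_mult[OF tendsto_const F0, of 2]] by simp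
      show "eventually (\<lambda>x. p x * g x + 2 * F x = p x * f1 x) (at_left 1)"
        using ev
      proof eventually_elim
        case (elim x)
        have "p x \<noteq> 0" using nz[OF elim] by (simp only: p_def of_real_eq_0_iff not_False_eq_True)
        moreover have "g x = f1 x - 2 * F x / p x"
          by (simp add: g_def p_def)
        ultimately show ?case by (simp add: field_simps)
      qed
    qed
    \<comment> \<open>Adding \<open>2 * p * f1\<close>, now known to tend to 0, to [f,1] recovers
      \<open>v\<close>.\<close>
    have ?B
      using tendsto_add[OF conjunct1[OF *] tendsto_mult[OF tendsto_const A, of 2]]
      by (simp add: mult.assoc)
    with A show "?A \<and> ?B" ..
  }
qed

section \<open>Integrability, reflection and the two forms\<close>

text \<open>On an interval of finite measure, |f| is dominated by the integrable function 1 + |f|^2.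
  Adding the endpoints to the interval changes nothing, as they form a null set. This supplies the
  primitive F of the converse direction.\<close>

lemma L2_imp_integrable:
  assumes "f \<in> L2"
  shows "f integrable_on {-1..1}"
proof -
  have "integrable (lebesgue_on {-1<..<1::real}) f"
  proof (rule Bochner_Integration.integrable_bound)
    show "integrable (lebesgue_on {-1<..<1::real}) (\<lambda>x. 1 + (norm (f x))\<^sup>2)"
      using assms by (auto simp: L2_def intro!: finite_measure.integrable_const finite_measureI
          simp: emeasure_restrict_space)
    show "f \<in> borel_measurable (lebesgue_on {-1<..<1::real})"
      using assms by (simp add: L2_def)
    have "t \<le> 1 + t\<^sup>2" for t :: real
      using sum_squares_bound[of t 1, simplified] zero_le_power2[of t] by linarith
    then show "AE x in lebesgue_on {-1<..<1}. norm (f x) \<le> norm (1 + (norm (f x))\<^sup>2)"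
      by (simp add: add_nonneg_nonneg)
  qed
  then show ?thesis
    by (simp add: integrable_on_lebesgue_on flip: integrable_on_open_interval_real)
qed

lemma differentiable_on_Ioo_imp_has_vector_derivative:
  fixes g :: "real \<Rightarrow> 'a :: real_normed_vector"
  assumes "g differentiable_on {a<..<b}" "x \<in> {a<..<b}"
  shows "(g has_vector_derivative vector_derivative g (at x)) (at x)"
  using assms by (simp add: differentiable_on_eq_differentiable_at flip: vector_derivative_works)

lemma has_vector_derivative_reflect:
  assumes "(g has_vector_derivative g') (at (- x :: real))"
  shows "((\<lambda>t. g (- t)) has_vector_derivative - g') (at x)"
proof -
  have "(uminus has_vector_derivative (-1 :: real)) (at x)"
    by (auto intro!: derivative_eq_intros)
  from vector_diff_chain_at[OF this assms] show ?thesis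
    by (simp add: o_def)
qed

lemma legendre_sq_form_1:
  "legendre_sq_form f (\<lambda>x. 1) x =
     Dx (\<lambda>t. of_real ((1 - t\<^sup>2)\<^sup>2) * Dx (Dx f) t) x - 2 * of_real (1 - x\<^sup>2) * Dx f x"
  by (simp add: legendre_sq_form_def)

lemma legendre_sq_form_x:
  "legendre_sq_form f of_real x =
     of_real x * (Dx (\<lambda>t. of_real ((1 - t\<^sup>2)\<^sup>2) * Dx (Dx f) t) x - 2 * of_real (1 - x\<^sup>2) * Dx f x)
     - (of_real (1 - x\<^sup>2))\<^sup>2 * Dx (Dx f) x + 2 * of_real (1 - x\<^sup>2) * f x"
proof -
  \<comment> \<open>The identity has first derivative 1 and hence second derivative 0, so both terms
    of the form with the second derivative of the second argument drop out.\<close>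
  have "Dx complex_of_real = (\<lambda>x. 1)"
    by (auto intro!: vector_derivative_at derivative_eq_intros has_vector_derivative_real_field)
  then show ?thesis
    by (simp add: legendre_sq_form_def algebra_simps)
qed

section \<open>Both endpoints together\<close>

text \<open>Both domains restrict \<open>max_domain\<close>, so only the endpoint conditions have to
  be compared. The equivalence at 1 is applied to \<open>f\<close> for the endpoint 1 and to x ->
  f(-x) for the endpoint -1.\<close>

lemma endpoint_conditions_eq:
  assumes "f \<in> max_domain"
  shows "vanishes_at_endpoints (\<lambda>x. of_real (1 - x\<^sup>2) * Dx f x) \<and>
      vanishes_at_endpoints (Dx (\<lambda>t. of_real ((1 - t\<^sup>2)\<^sup>2) * Dx (Dx f) t)) \<longleftrightarrow>
    vanishes_at_endpoints (legendre_sq_form f (\<lambda>x. 1)) \<and>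
      vanishes_at_endpoints (legendre_sq_form f (\<lambda>x. of_real x))"
proof -
  define f1 f2 where "f1 = Dx f" and "f2 = Dx f1"
  define u where "u = (\<lambda>t. complex_of_real ((1 - t\<^sup>2)\<^sup>2) * f2 t)"
  define v where "v = Dx u"
  have dif: "f differentiable_on {-1<..<1}" "f1 differentiable_on {-1<..<1}"
      "f2 differentiable_on {-1<..<1}"
    using assms by (simp_all add: max_domain_def AC_loc3_def f1_def f2_def)
  have f: "(f has_vector_derivative f1 x) (at x)" if "x \<in> {-1<..<1}" for x
    using dif(1) that unfolding f1_def by (rule differentiable_on_Ioo_imp_has_vector_derivative)
  have f1: "(f1 has_vector_derivative f2 x) (at x)" if "x \<in> {-1<..<1}" for x
    using dif(2) that unfolding f2_def by (rule differentiable_on_Ioo_imp_has_vector_derivative)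
  \<comment> \<open>Since \<open>Dx\<close> is total, \<open>v\<close> is a genuine derivative only
    once \<open>u\<close> is known to be differentiable; this follows from the differentiability of
    the weight and of \<open>f2\<close>.\<close>
  have "(\<lambda>t. complex_of_real ((1 - t\<^sup>2)\<^sup>2)) differentiable (at x)" for x
  proof -
    have "((\<lambda>t. (1 - t\<^sup>2)\<^sup>2) has_real_derivative - 4 * x * (1 - x\<^sup>2)) (at x)"
      by (auto intro!: derivative_eq_intros)
    then show ?thesis
      by (rule differentiableI_vector[OF has_vector_derivative_of_real])
  qed
  then have "(\<lambda>t. complex_of_real ((1 - t\<^sup>2)\<^sup>2)) differentiable_on {-1<..<1}"
    by (simp add: differentiable_at_imp_differentiable_on)
  then have "u differentiable_on {-1<..<1}"
    unfolding u_def by (intro differentiable_on_mult dif)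
  then have v: "(u has_vector_derivative v x) (at x)" if "x \<in> {-1<..<1}" for x
    unfolding v_def using that by (rule differentiable_on_Ioo_imp_has_vector_derivative)
  have int: "f integrable_on {-1..1}"
    using assms by (simp add: max_domain_def L2_imp_integrable)
  then have int_right: "f integrable_on {0..1}" and int_left: "f integrable_on {-1..0}"
    by (rule integrable_on_subinterval; simp)+
  have right: "((\<lambda>x. of_real (1 - x\<^sup>2) * f1 x) \<longlongrightarrow> 0) (at_left 1) \<and>
      (v \<longlongrightarrow> 0) (at_left 1) \<longleftrightarrow>
    ((\<lambda>x. v x - 2 * of_real (1 - x\<^sup>2) * f1 x) \<longlongrightarrow> 0) (at_left 1) \<and>
    ((\<lambda>x. of_real x * (v x - 2 * of_real (1 - x\<^sup>2) * f1 x)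
      - (of_real (1 - x\<^sup>2))\<^sup>2 * f2 x + 2 * of_real (1 - x\<^sup>2) * f x) \<longlongrightarrow> 0) (at_left 1)"
    by (rule endpoint_conditions_iff[of f f1 f2 v, folded u_def])
       (simp_all add: f f1 v int_right)
  \<comment> \<open>For x -> f(-x) the roles of \<open>f1\<close>, \<open>f2\<close>,
    \<open>v\<close> are played by -f1(-x), f2(-x), -v(-x): each differentiation contributes a sign,
    and the weight is even.\<close>
  have "((\<lambda>x. of_real (1 - x\<^sup>2) * - f1 (- x)) \<longlongrightarrow> 0) (at_left 1) \<and>
      ((\<lambda>x. - v (- x)) \<longlongrightarrow> 0) (at_left 1) \<longleftrightarrow>
    ((\<lambda>x. - v (- x) - 2 * of_real (1 - x\<^sup>2) * - f1 (- x)) \<longlongrightarrow> 0) (at_left 1) \<and>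
    ((\<lambda>x. of_real x * (- v (- x) - 2 * of_real (1 - x\<^sup>2) * - f1 (- x))
      - (of_real (1 - x\<^sup>2))\<^sup>2 * f2 (- x) + 2 * of_real (1 - x\<^sup>2) * f (- x)) \<longlongrightarrow> 0) (at_left 1)"
  proof (rule endpoint_conditions_iff)
    fix x :: real assume "x \<in> {0<..<1}"
    then have x: "- x \<in> {-1<..<1}" by simp
    show "((\<lambda>x. f (- x)) has_vector_derivative - f1 (- x)) (at x)"
      by (rule has_vector_derivative_reflect f x)+
    show "((\<lambda>x. - f1 (- x)) has_vector_derivative f2 (- x)) (at x)"
      using has_vector_derivative_minus[OF has_vector_derivative_reflect[OF f1[OF x]]] by simp
    show "((\<lambda>t. of_real ((1 - t\<^sup>2)\<^sup>2) * f2 (- t)) has_vector_derivative - v (- x)) (at x)"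
      using has_vector_derivative_reflect[OF v[OF x]] by (simp add: u_def)
  next
    show "(\<lambda>x. f (- x)) integrable_on {0..1}"
      using int_left
        Henstock_Kurzweil_Integration.integrable_reflect_real[where f = f and a = "-1" and b = 0]
      by simp
  qed
  \<comment> \<open>After replacing -x by x, the first three functions are the negatives of those
    wanted at -1, which does not affect a limit 0. In the fourth the signs of x and of [f,1]
    cancel.\<close>
  moreover have "((\<lambda>x. - h x) \<longlongrightarrow> 0) F \<longleftrightarrow> (h \<longlongrightarrow> 0) F" for h :: "real \<Rightarrow> complex" and F
    using tendsto_minus_cancel_left[of h 0 F] by simp
  ultimately have left: "((\<lambda>x. of_real (1 - x\<^sup>2) * f1 x) \<longlongrightarrow> 0) (at_right (-1)) \<and>
      (v \<longlongrightarrow> 0) (at_right (-1)) \<longleftrightarrow>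
    ((\<lambda>x. v x - 2 * of_real (1 - x\<^sup>2) * f1 x) \<longlongrightarrow> 0) (at_right (-1)) \<and>
    ((\<lambda>x. of_real x * (v x - 2 * of_real (1 - x\<^sup>2) * f1 x)
      - (of_real (1 - x\<^sup>2))\<^sup>2 * f2 x + 2 * of_real (1 - x\<^sup>2) * f x) \<longlongrightarrow> 0) (at_right (-1))"
    unfolding at_right_minus[of "-1"] filterlim_filtermap
    by (simp only: mult_minus_right mult_minus_left of_real_minus power2_minus minus_minus
        minus_diff_minus)
  show ?thesis
    using left right
    unfolding vanishes_at_endpoints_def legendre_sq_form_1 legendre_sq_form_x
      v_def u_def f2_def f1_def
    by blast
qed

theorem theorem5:
  shows "dom_D = dom_S"
  unfolding dom_D_def dom_S_def using endpoint_conditions_eq by blast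

end
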